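(* Let $G$ and $N$ be finite groups having the same order. For maps $\mathfrak{f}\in\mathrm{Map}(G,\mathrm{Aut}(N))$ and $\mathfrak{g}\in\mathrm{Map}(G,N)$, define $$\beta_{(\mathfrak{f},\mathfrak{g})}:G\longrightarrow\mathrm{Hol}(N);\qquad \beta_{(\mathfrak{f},\mathfrak{g})}(\sigma)=\rho(\mathfrak{g}(\sigma))\cdot\mathfrak{f}(\sigma).$$ Then \begin{align*} \mathrm{Map}(G,\mathrm{Hol}(N))&=\{\beta_{(\mathfrak{f},\mathfrak{g})}:\mathfrak{f}\in\mathrm{Map}(G,\mathrm{Aut}(N))\text{ and }\mathfrak{g}\in\mathrm{Map}(G,N)\},\\ \mathrm{Hom}(G,\mathrm{Hol}(N))&=\{\beta_{(\mathfrak{f},\mathfrak{g})}:\mathfrak{f}\in\mathrm{Hom}(G,\mathrm{Aut}(N))\text{ and }\mathfrak{g}\in Z^1_{\mathfrak{f}}(G,N)\},\\ \mathrm{Reg}(G,\mathrm{Hol}(N))&=\{\beta_{(\mathfrak{f},\mathfrak{g})}:\mathfrak{f}\in\mathrm{Hom}(G,\mathrm{Aut}(N))\text{ and }\mathfrak{g}\in Z^1_{\mathfrak{f}}(G,N)^*\}. \end{align*}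
   Context: All groups are finite. $\mathrm{Map}(X,Y)$ is the set of all maps $X\to Y$ and $\mathrm{Hom}$ the set of group homomorphisms. $\mathrm{Perm}(N)$ is the symmetric group on the set $N$; $\rho,\lambda:N\to\mathrm{Perm}(N)$ are the regular representations $\rho(\eta)=(x\mapsto x\eta^{-1})$ and $\lambda(\eta)=(x\mapsto\eta x)$. The holomorph is $\mathrm{Hol}(N)=\{\pi\in\mathrm{Perm}(N):\pi\text{ normalizes }\lambda(N)\}$; one has $\mathrm{Hol}(N)=\rho(N)\rtimes\mathrm{Aut}(N)$. A subgroup $R$ of $\mathrm{Perm}(N)$ is regular if the map $R\to N$, $\pi\mapsto\pi(1_N)$, is bijective. $\mathrm{Reg}(G,\mathrm{Hol}(N))=\{\beta\in\mathrm{Hom}(G,\mathrm{Hol}(N)):\beta(G)\text{ is regular}\}$. For $\mathfrak{f}\in\mathrm{Hom}(G,\mathrm{Aut}(N))$, $Z^1_{\mathfrak{f}}(G,N)$ is the set of crossed homomorphisms with respect to $\mathfrak{f}$, i.e. maps $\mathfrak{g}:G\to N$ with $\mathfrak{g}(\sigma_1\sigma_2)=\mathfrak{g}(\sigma_1)\cdot\mathfrak{f}(\sigma_1)(\mathfrak{g}(\sigma_2))$ for all $\sigma_1,\sigma_2\in G$, and $Z^1_{\mathfrak{f}}(G,N)^*$ is the subset of those which are bijective. *)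

theory Defs
  imports "HOL-Algebra.Algebra"
begin

text \<open>
  Maps $X \to Y$ are rendered as the extensional function space \<open>X \<rightarrow>\<^sub>E Y\<close>, so that
  equality of maps is equality of HOL functions. In particular \<open>Perm(N)\<close> is
  \<^term>\<open>BijGroup (carrier N)\<close>, whose product is composition (right factor applied first),
  and \<open>Aut(N)\<close> is \<^term>\<open>AutoGroup N\<close>.
\<close>

definition Map :: "('a, 'c) monoid_scheme \<Rightarrow> ('b, 'd) monoid_scheme \<Rightarrow> ('a \<Rightarrow> 'b) set" where
  "Map G H = (carrier G \<rightarrow>\<^sub>E carrier H)"

text \<open>The library's \<^const>\<open>hom\<close> leaves values outside the carrier arbitrary.\<close>

definition Hom :: "('a, 'c) monoid_scheme \<Rightarrow> ('b, 'd) monoid_scheme \<Rightarrow> ('a \<Rightarrow> 'b) set" where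
  "Hom G H = hom G H \<inter> extensional (carrier G)"

abbreviation Perm :: "('b, 'd) monoid_scheme \<Rightarrow> ('b \<Rightarrow> 'b) monoid" where
  "Perm N \<equiv> BijGroup (carrier N)"

definition right_reg :: "('b, 'd) monoid_scheme \<Rightarrow> 'b \<Rightarrow> 'b \<Rightarrow> 'b" where
  "right_reg N \<eta> = (\<lambda>x\<in>carrier N. x \<otimes>\<^bsub>N\<^esub> inv\<^bsub>N\<^esub> \<eta>)"

definition left_reg :: "('b, 'd) monoid_scheme \<Rightarrow> 'b \<Rightarrow> 'b \<Rightarrow> 'b" where
  "left_reg N \<eta> = (\<lambda>x\<in>carrier N. \<eta> \<otimes>\<^bsub>N\<^esub> x)"

definition Hol :: "('b, 'd) monoid_scheme \<Rightarrow> ('b \<Rightarrow> 'b) monoid" where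
  "Hol N = (Perm N)\<lparr>carrier := normalizer (Perm N) (left_reg N ` carrier N)\<rparr>"

definition regular_subgroup :: "('b, 'd) monoid_scheme \<Rightarrow> ('b \<Rightarrow> 'b) set \<Rightarrow> bool" where
  "regular_subgroup N R \<longleftrightarrow>
     subgroup R (Perm N) \<and> bij_betw (\<lambda>\<pi>. \<pi> \<one>\<^bsub>N\<^esub>) R (carrier N)"

definition Reg_Hol :: "('a, 'c) monoid_scheme \<Rightarrow> ('b, 'd) monoid_scheme \<Rightarrow> ('a \<Rightarrow> 'b \<Rightarrow> 'b) set" where
  "Reg_Hol G N = {\<beta> \<in> Hom G (Hol N). regular_subgroup N (\<beta> ` carrier G)}"

definition crossed_homs ::
  "('a, 'c) monoid_scheme \<Rightarrow> ('b, 'd) monoid_scheme \<Rightarrow> ('a \<Rightarrow> 'b \<Rightarrow> 'b) \<Rightarrow> ('a \<Rightarrow> 'b) set" where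
  "crossed_homs G N \<ff> =
     {\<gg> \<in> Map G N. \<forall>\<sigma>\<^sub>1\<in>carrier G. \<forall>\<sigma>\<^sub>2\<in>carrier G.
        \<gg> (\<sigma>\<^sub>1 \<otimes>\<^bsub>G\<^esub> \<sigma>\<^sub>2) = \<gg> \<sigma>\<^sub>1 \<otimes>\<^bsub>N\<^esub> \<ff> \<sigma>\<^sub>1 (\<gg> \<sigma>\<^sub>2)}"

definition bij_crossed_homs ::
  "('a, 'c) monoid_scheme \<Rightarrow> ('b, 'd) monoid_scheme \<Rightarrow> ('a \<Rightarrow> 'b \<Rightarrow> 'b) \<Rightarrow> ('a \<Rightarrow> 'b) set" where
  "bij_crossed_homs G N \<ff> = {\<gg> \<in> crossed_homs G N \<ff>. bij_betw \<gg> (carrier G) (carrier N)}"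

definition beta ::
  "('a, 'c) monoid_scheme \<Rightarrow> ('b, 'd) monoid_scheme \<Rightarrow> ('a \<Rightarrow> 'b \<Rightarrow> 'b) \<Rightarrow> ('a \<Rightarrow> 'b) \<Rightarrow> 'a \<Rightarrow> 'b \<Rightarrow> 'b" where
  "beta G N \<ff> \<gg> = (\<lambda>\<sigma>\<in>carrier G. right_reg N (\<gg> \<sigma>) \<otimes>\<^bsub>Perm N\<^esub> \<ff> \<sigma>)"

end

theory Submission
  imports Defs
begin

text \<open>
  Everything rests on the factorisation \<open>Hol(N) = \<rho>(N) \<cdot> Aut(N)\<close>. If \<open>\<pi>\<close> normalises
  \<open>\<lambda>(N)\<close>, then \<open>\<pi> \<lambda>(\<theta>) = \<lambda>(\<theta>') \<pi>\<close> for some \<open>\<theta>'\<close>, and evaluation at \<open>1\<close> forces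
  \<open>\<theta>' = \<pi>(\<theta>) \<pi>(1)\<inverse>\<close>. Hence \<open>\<theta> \<mapsto> \<pi>(\<theta>) \<pi>(1)\<inverse>\<close> is multiplicative: it is an automorphism
  \<open>f\<close> with \<open>\<pi> = \<rho>(\<pi>(1)\<inverse>) f\<close> (\<open>Hol_imp_factorisation\<close>). The factors are unique, because
  the value of \<open>\<rho>(\<eta>) f\<close> at \<open>1\<close> is \<open>\<eta>\<inverse>\<close>, which recovers \<open>\<eta>\<close> and then \<open>f\<close>
  (\<open>hol_elem_inject\<close>).

  Factoring each value of a map \<open>G \<rightarrow> Hol(N)\<close> gives the first equality. For the second, the
  product rule \<open>\<rho>(\<eta>\<^sub>1) f\<^sub>1 \<cdot> \<rho>(\<eta>\<^sub>2) f\<^sub>2 = \<rho>(\<eta>\<^sub>1 f\<^sub>1(\<eta>\<^sub>2)) f\<^sub>1 f\<^sub>2\<close> (\<open>hol_elem_mult\<close>) and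
  uniqueness turn multiplicativity of \<open>\<beta>\<close> into multiplicativity of \<open>\<ff>\<close> together with the
  crossed homomorphism identity for \<open>\<gg>\<close> (\<open>beta_in_Hom_iff\<close>). For the third, \<open>\<beta>(\<sigma>)(1) = \<gg>(\<sigma>)\<inverse>\<close>,
  so regularity of \<open>\<beta>(G)\<close> amounts to bijectivity of \<open>\<gg>\<close>; that \<open>\<beta>\<close> is injective when its
  image is regular comes from the equality of the orders of \<open>G\<close> and \<open>N\<close> (\<open>beta_in_Reg_Hol_iff\<close>).
\<close>

section \<open>Normalisers and regular representations\<close>

text \<open>
  The form \<open>\<pi> H = H \<pi>\<close> of the normaliser condition avoids inverses, which are awkward to
  compute in a group of extensional bijections.
\<close>

lemma (in group) mem_normalizer_iff:
  assumes "H \<subseteq> carrier G"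
  shows "a \<in> normalizer G H \<longleftrightarrow> a \<in> carrier G \<and> a <# H = H #> a"
proof (cases "a \<in> carrier G")
  case True
  have lcos: "a <# H \<subseteq> carrier G"
    using assms True by (rule l_coset_subset_G)
  have "a <# H #> inv a = H \<longleftrightarrow> a <# H = H #> a"
  proof
    assume eq: "a <# H #> inv a = H"
    have "a <# H = a <# H #> inv a #> a"
      using lcos True by (simp add: coset_mult_assoc)
    then show "a <# H = H #> a"
      by (simp only: eq)
  next
    assume "a <# H = H #> a"
    then show "a <# H #> inv a = H"
      using assms True by (simp add: coset_mult_assoc)
  qed
  then show ?thesis
    using assms True by (simp add: normalizer_def stabilizer_def)
qed (simp add: normalizer_def stabilizer_def)

lemma Perm_mult_apply:
  assumes "\<pi> \<in> Bij (carrier N)" "\<pi>' \<in> Bij (carrier N)" "x \<in> carrier N"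
  shows "(\<pi> \<otimes>\<^bsub>Perm N\<^esub> \<pi>') x = \<pi> (\<pi>' x)"
  using assms by (simp add: BijGroup_def compose_eq)

lemma Perm_mult_closed:
  assumes "\<pi> \<in> Bij (carrier N)" "\<pi>' \<in> Bij (carrier N)"
  shows "\<pi> \<otimes>\<^bsub>Perm N\<^esub> \<pi>' \<in> Bij (carrier N)"
  using assms by (simp add: BijGroup_def compose_Bij)

lemma Bij_eqI:
  assumes "\<pi> \<in> Bij S" "\<pi>' \<in> Bij S" "\<And>x. x \<in> S \<Longrightarrow> \<pi> x = \<pi>' x"
  shows "\<pi> = \<pi>'"
  using assms by (blast intro: extensionalityI Bij_imp_extensional)

lemma Bij_closed: "\<lbrakk>\<pi> \<in> Bij S; x \<in> S\<rbrakk> \<Longrightarrow> \<pi> x \<in> S"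
  by (blast dest: Bij_imp_funcset)

lemma (in group) auto_closed: "\<lbrakk>f \<in> auto G; x \<in> carrier G\<rbrakk> \<Longrightarrow> f x \<in> carrier G"
  by (simp add: auto_def Bij_closed)

lemma (in group) auto_mult:
  "\<lbrakk>f \<in> auto G; x \<in> carrier G; y \<in> carrier G\<rbrakk> \<Longrightarrow> f (x \<otimes> y) = f x \<otimes> f y"
  by (simp add: auto_def hom_mult)

lemma (in group) auto_is_group_hom: "f \<in> auto G \<Longrightarrow> group_hom G G f"
  by unfold_locales (simp add: auto_def)

lemma (in group) right_reg_in_Bij:
  assumes "\<eta> \<in> carrier G"
  shows "right_reg G \<eta> \<in> Bij (carrier G)"
proof -
  have "bij_betw (right_reg G \<eta>) (carrier G) (carrier G)"
    by (rule bij_betw_byWitness[where f' = "\<lambda>x. x \<otimes> \<eta>"])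
       (use assms in \<open>auto simp: right_reg_def m_assoc\<close>)
  then show ?thesis
    by (simp add: Bij_def right_reg_def)
qed

lemma (in group) left_reg_in_Bij:
  assumes "\<eta> \<in> carrier G"
  shows "left_reg G \<eta> \<in> Bij (carrier G)"
proof -
  have "bij_betw (left_reg G \<eta>) (carrier G) (carrier G)"
    by (rule bij_betw_byWitness[where f' = "\<lambda>x. inv \<eta> \<otimes> x"])
       (use assms in \<open>auto simp: left_reg_def m_assoc[symmetric]\<close>)
  then show ?thesis
    by (simp add: Bij_def left_reg_def)
qed

section \<open>The holomorph as a product of translations and automorphisms\<close>

abbreviation hol_elem :: "('b, 'd) monoid_scheme \<Rightarrow> 'b \<Rightarrow> ('b \<Rightarrow> 'b) \<Rightarrow> 'b \<Rightarrow> 'b" where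
  "hol_elem N \<eta> f \<equiv> right_reg N \<eta> \<otimes>\<^bsub>Perm N\<^esub> f"

lemma (in group) hol_elem_in_Bij:
  assumes "\<eta> \<in> carrier G" "f \<in> auto G"
  shows "hol_elem G \<eta> f \<in> Bij (carrier G)"
  using assms by (simp add: Perm_mult_closed right_reg_in_Bij auto_def)

lemma (in group) hol_elem_apply:
  assumes "\<eta> \<in> carrier G" "f \<in> auto G" "x \<in> carrier G"
  shows "hol_elem G \<eta> f x = f x \<otimes> inv \<eta>"
proof -
  have "hol_elem G \<eta> f x = right_reg G \<eta> (f x)"
    using assms by (intro Perm_mult_apply right_reg_in_Bij) (simp_all add: auto_def)
  then show ?thesis
    using assms by (simp add: right_reg_def auto_closed)
qed

lemma (in group) hol_elem_one:
  assumes "\<eta> \<in> carrier G" "f \<in> auto G"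
  shows "hol_elem G \<eta> f \<one> = inv \<eta>"
  using assms by (simp add: hol_elem_apply group_hom.hom_one[OF auto_is_group_hom])

text \<open>The value at \<open>1\<close> determines \<open>\<eta>\<close>, and then \<open>\<rho>(\<eta>)\<close> can be cancelled.\<close>

lemma (in group) hol_elem_inject:
  assumes "\<eta> \<in> carrier G" "f \<in> auto G" "\<eta>' \<in> carrier G" "f' \<in> auto G"
    and eq: "hol_elem G \<eta> f = hol_elem G \<eta>' f'"
  shows "\<eta> = \<eta>' \<and> f = f'"
proof
  have "inv \<eta> = inv \<eta>'"
    using assms hol_elem_one by metis
  then show "\<eta> = \<eta>'"
    using assms by (metis inv_inv)
  show "f = f'"
  proof (rule Bij_eqI)
    fix x assume "x \<in> carrier G"
    then have "f x \<otimes> inv \<eta> = f' x \<otimes> inv \<eta>"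
      using assms \<open>\<eta> = \<eta>'\<close> hol_elem_apply by metis
    then show "f x = f' x"
      using assms \<open>x \<in> carrier G\<close> by (simp add: auto_closed)
  qed (use assms in \<open>simp_all add: auto_def\<close>)
qed

text \<open>
  An automorphism moves past \<open>\<rho>\<close> by \<open>f \<rho>(\<eta>) = \<rho>(f(\<eta>)) f\<close>; this twist is the source of the
  crossed homomorphism identity.
\<close>

lemma (in group) hol_elem_mult:
  assumes "\<eta>\<^sub>1 \<in> carrier G" "f\<^sub>1 \<in> auto G" "\<eta>\<^sub>2 \<in> carrier G" "f\<^sub>2 \<in> auto G"
  shows "hol_elem G \<eta>\<^sub>1 f\<^sub>1 \<otimes>\<^bsub>Perm G\<^esub> hol_elem G \<eta>\<^sub>2 f\<^sub>2
       = hol_elem G (\<eta>\<^sub>1 \<otimes> f\<^sub>1 \<eta>\<^sub>2) (f\<^sub>1 \<otimes>\<^bsub>Perm G\<^esub> f\<^sub>2)"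
proof -
  interpret f\<^sub>1: group_hom G G f\<^sub>1
    using assms by (intro auto_is_group_hom)
  have auto12: "f\<^sub>1 \<otimes>\<^bsub>Perm G\<^esub> f\<^sub>2 \<in> auto G"
    using assms subgroup_auto by (blast dest: subgroup.m_closed)
  show ?thesis
  proof (rule Bij_eqI)
    fix x assume x: "x \<in> carrier G"
    have "(f\<^sub>1 \<otimes>\<^bsub>Perm G\<^esub> f\<^sub>2) x = f\<^sub>1 (f\<^sub>2 x)"
      using assms x by (intro Perm_mult_apply) (simp_all add: auto_def)
    then show "(hol_elem G \<eta>\<^sub>1 f\<^sub>1 \<otimes>\<^bsub>Perm G\<^esub> hol_elem G \<eta>\<^sub>2 f\<^sub>2) x
        = hol_elem G (\<eta>\<^sub>1 \<otimes> f\<^sub>1 \<eta>\<^sub>2) (f\<^sub>1 \<otimes>\<^bsub>Perm G\<^esub> f\<^sub>2) x"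
      using assms auto12 x
      by (simp add: Perm_mult_apply hol_elem_in_Bij hol_elem_apply auto_closed
          inv_mult_group m_assoc)
  qed (use assms auto12 in \<open>simp_all add: Perm_mult_closed hol_elem_in_Bij auto_closed\<close>)
qed

lemma (in group) carrier_Hol_iff:
  "\<pi> \<in> carrier (Hol G) \<longleftrightarrow> \<pi> \<in> Bij (carrier G) \<and>
     \<pi> <#\<^bsub>Perm G\<^esub> (left_reg G ` carrier G) = (left_reg G ` carrier G) #>\<^bsub>Perm G\<^esub> \<pi>"
proof -
  have "left_reg G ` carrier G \<subseteq> carrier (Perm G)"
    by (auto simp: BijGroup_def left_reg_in_Bij)
  from group.mem_normalizer_iff[OF group_BijGroup this] show ?thesis
    by (simp add: Hol_def) (simp add: BijGroup_def)
qed

text \<open>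
  Since \<open>\<rho>(\<eta>)\<close> centralises \<open>\<lambda>(N)\<close> and \<open>f \<lambda>(\<theta>) = \<lambda>(f(\<theta>)) f\<close>, conjugation by \<open>\<rho>(\<eta>) f\<close> permutes
  \<open>\<lambda>(N)\<close> the way \<open>f\<close> permutes \<open>N\<close>.
\<close>

lemma (in group) hol_elem_in_Hol:
  assumes "\<eta> \<in> carrier G" "f \<in> auto G"
  shows "hol_elem G \<eta> f \<in> carrier (Hol G)"
proof -
  let ?\<pi> = "hol_elem G \<eta> f"
  have \<pi>: "?\<pi> \<in> Bij (carrier G)"
    using assms by (rule hol_elem_in_Bij)
  have swap: "?\<pi> \<otimes>\<^bsub>Perm G\<^esub> left_reg G \<theta> = left_reg G (f \<theta>) \<otimes>\<^bsub>Perm G\<^esub> ?\<pi>"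
    if \<theta>: "\<theta> \<in> carrier G" for \<theta>
  proof (rule Bij_eqI)
    fix x assume x: "x \<in> carrier G"
    have "?\<pi> (\<theta> \<otimes> x) = f \<theta> \<otimes> ?\<pi> x"
      using assms \<theta> x by (simp add: hol_elem_apply auto_mult auto_closed m_assoc)
    then show "(?\<pi> \<otimes>\<^bsub>Perm G\<^esub> left_reg G \<theta>) x = (left_reg G (f \<theta>) \<otimes>\<^bsub>Perm G\<^esub> ?\<pi>) x"
      using assms \<pi> \<theta> x
      by (simp add: Perm_mult_apply left_reg_in_Bij auto_closed)
         (simp add: left_reg_def Bij_closed)
  qed (use assms \<pi> \<theta> in \<open>simp_all add: Perm_mult_closed left_reg_in_Bij auto_closed\<close>)
  have "f ` carrier G = carrier G"
    using assms by (auto simp: auto_def Bij_def bij_betw_def)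
  then have "(\<lambda>\<theta>. left_reg G \<theta> \<otimes>\<^bsub>Perm G\<^esub> ?\<pi>) ` carrier G
           = (\<lambda>\<theta>. left_reg G (f \<theta>) \<otimes>\<^bsub>Perm G\<^esub> ?\<pi>) ` carrier G"
    by (subst image_image[of "\<lambda>\<theta>. left_reg G \<theta> \<otimes>\<^bsub>Perm G\<^esub> ?\<pi>" f, symmetric]) (simp only:)
  also have "\<dots> = (\<lambda>\<theta>. ?\<pi> \<otimes>\<^bsub>Perm G\<^esub> left_reg G \<theta>) ` carrier G"
    by (rule image_cong) (simp_all add: swap)
  finally have "?\<pi> <#\<^bsub>Perm G\<^esub> (left_reg G ` carrier G) = (left_reg G ` carrier G) #>\<^bsub>Perm G\<^esub> ?\<pi>"
    by (auto simp: l_coset_def r_coset_def)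
  with \<pi> show ?thesis
    by (simp add: carrier_Hol_iff)
qed

text \<open>
  With \<open>a = \<pi>(1)\<close>, the product \<open>f = \<rho>(a) \<pi>\<close> fixes \<open>1\<close>, so it is the only candidate for the
  automorphism part. Normalising \<open>\<lambda>(N)\<close> gives \<open>\<pi>(\<theta> x) = f(\<theta>) \<pi>(x)\<close>, and right multiplication
  by \<open>a\<inverse>\<close> turns this into multiplicativity of \<open>f\<close>.
\<close>

lemma (in group) Hol_imp_factorisation:
  assumes "\<pi> \<in> carrier (Hol G)"
  obtains \<eta> f where "\<eta> \<in> carrier G" "f \<in> auto G" "\<pi> = hol_elem G \<eta> f"
proof
  have \<pi>: "\<pi> \<in> Bij (carrier G)"
    and norm: "\<pi> <#\<^bsub>Perm G\<^esub> (left_reg G ` carrier G) = (left_reg G ` carrier G) #>\<^bsub>Perm G\<^esub> \<pi>"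
    using assms by (simp_all add: carrier_Hol_iff)
  have \<pi>_closed: "\<pi> x \<in> carrier G" if "x \<in> carrier G" for x
    using \<pi> that by (rule Bij_closed)
  let ?a = "\<pi> \<one>"
  let ?f = "right_reg G ?a \<otimes>\<^bsub>Perm G\<^esub> \<pi>"
  have f_Bij: "?f \<in> Bij (carrier G)"
    using \<pi> by (simp add: Perm_mult_closed right_reg_in_Bij \<pi>_closed)
  have f_apply: "?f x = \<pi> x \<otimes> inv ?a" if "x \<in> carrier G" for x
  proof -
    have "?f x = right_reg G ?a (\<pi> x)"
      using \<pi> that by (intro Perm_mult_apply right_reg_in_Bij \<pi>_closed) simp_all
    then show ?thesis
      using that by (simp add: right_reg_def \<pi>_closed)
  qed
  have \<pi>_mult: "\<pi> (\<theta> \<otimes> x) = ?f \<theta> \<otimes> \<pi> x"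
    if \<theta>: "\<theta> \<in> carrier G" and x: "x \<in> carrier G" for \<theta> x
  proof -
    have "\<pi> \<otimes>\<^bsub>Perm G\<^esub> left_reg G \<theta> \<in> (left_reg G ` carrier G) #>\<^bsub>Perm G\<^esub> \<pi>"
      using \<theta> unfolding norm[symmetric] by (auto simp: l_coset_def)
    then obtain \<theta>' where \<theta>': "\<theta>' \<in> carrier G"
      and eq: "\<pi> \<otimes>\<^bsub>Perm G\<^esub> left_reg G \<theta> = left_reg G \<theta>' \<otimes>\<^bsub>Perm G\<^esub> \<pi>"
      by (auto simp: r_coset_def)
    have ev: "\<pi> (\<theta> \<otimes> y) = \<theta>' \<otimes> \<pi> y" if y: "y \<in> carrier G" for y
    proof -
      have "\<pi> (left_reg G \<theta> y) = (\<pi> \<otimes>\<^bsub>Perm G\<^esub> left_reg G \<theta>) y"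
        using \<pi> \<theta> y by (simp add: Perm_mult_apply left_reg_in_Bij)
      also have "\<dots> = left_reg G \<theta>' (\<pi> y)"
        using \<pi> \<theta>' y by (simp add: eq Perm_mult_apply left_reg_in_Bij)
      finally show ?thesis
        using \<theta> \<theta>' y by (simp add: left_reg_def \<pi>_closed)
    qed
    have "\<theta>' = ?f \<theta>"
      using ev[of \<one>] \<theta> \<theta>' by (simp add: f_apply \<pi>_closed m_assoc)
    with ev x show ?thesis
      by simp
  qed
  show f_auto: "?f \<in> auto G"
    unfolding auto_def
  proof (intro IntI homI f_Bij)
    fix x y assume xy: "x \<in> carrier G" "y \<in> carrier G"
    then show "?f x \<in> carrier G"
      by (simp add: f_apply \<pi>_closed)
    with xy show "?f (x \<otimes> y) = ?f x \<otimes> ?f y"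
      by (simp add: f_apply[of "x \<otimes> y"] f_apply[of y] \<pi>_mult \<pi>_closed m_assoc)
  qed
  show inv_a: "inv ?a \<in> carrier G"
    by (simp add: \<pi>_closed)
  show "\<pi> = hol_elem G (inv ?a) ?f"
  proof (rule Bij_eqI[OF \<pi> hol_elem_in_Bij[OF inv_a f_auto]])
    fix x assume "x \<in> carrier G"
    then show "\<pi> x = hol_elem G (inv ?a) ?f x"
      by (simp add: hol_elem_apply[OF inv_a f_auto] f_apply \<pi>_closed m_assoc)
  qed
qed

section \<open>Homomorphisms into the holomorph\<close>

lemma carrier_AutoGroup: "carrier (AutoGroup N) = auto N"
  by (simp add: AutoGroup_def)

lemma mult_AutoGroup: "f \<otimes>\<^bsub>AutoGroup N\<^esub> f' = f \<otimes>\<^bsub>Perm N\<^esub> f'"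
  by (simp add: AutoGroup_def)

lemma mult_Hol: "\<pi> \<otimes>\<^bsub>Hol N\<^esub> \<pi>' = \<pi> \<otimes>\<^bsub>Perm N\<^esub> \<pi>'"
  by (simp add: Hol_def)

lemma beta_in_Map:
  assumes "group N" "\<ff> \<in> Map G (AutoGroup N)" "\<gg> \<in> Map G N"
  shows "beta G N \<ff> \<gg> \<in> Map G (Hol N)"
proof -
  have "\<gg> \<sigma> \<in> carrier N \<and> \<ff> \<sigma> \<in> auto N" if "\<sigma> \<in> carrier G" for \<sigma>
    using assms that by (auto simp: Map_def carrier_AutoGroup)
  then show ?thesis
    using group.hol_elem_in_Hol[OF assms(1)] by (simp add: Map_def beta_def)
qed

lemma Map_Hol_imp_beta:
  assumes "group N" "\<beta> \<in> Map G (Hol N)"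
  obtains \<ff> \<gg> where "\<ff> \<in> Map G (AutoGroup N)" "\<gg> \<in> Map G N" "\<beta> = beta G N \<ff> \<gg>"
proof -
  have "\<forall>\<sigma>\<in>carrier G. \<exists>\<eta> f. \<eta> \<in> carrier N \<and> f \<in> auto N \<and> \<beta> \<sigma> = hol_elem N \<eta> f"
  proof
    fix \<sigma> assume "\<sigma> \<in> carrier G"
    then have "\<beta> \<sigma> \<in> carrier (Hol N)"
      using assms(2) by (auto simp: Map_def)
    then show "\<exists>\<eta> f. \<eta> \<in> carrier N \<and> f \<in> auto N \<and> \<beta> \<sigma> = hol_elem N \<eta> f"
      by (rule group.Hol_imp_factorisation[OF assms(1)]) blast
  qed
  then obtain \<gg> \<ff> where *: "\<And>\<sigma>. \<sigma> \<in> carrier G \<Longrightarrow>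
      \<gg> \<sigma> \<in> carrier N \<and> \<ff> \<sigma> \<in> auto N \<and> \<beta> \<sigma> = hol_elem N (\<gg> \<sigma>) (\<ff> \<sigma>)"
    by metis
  show thesis
  proof
    show "restrict \<ff> (carrier G) \<in> Map G (AutoGroup N)" "restrict \<gg> (carrier G) \<in> Map G N"
      using * by (auto simp: Map_def carrier_AutoGroup)
    show "\<beta> = beta G N (restrict \<ff> (carrier G)) (restrict \<gg> (carrier G))"
      using assms(2) *
      by (intro extensionalityI[where A = "carrier G"]) (auto simp: Map_def beta_def PiE_def)
  qed
qed

lemma Hom_iff:
  "h \<in> Hom G H \<longleftrightarrow> h \<in> Map G H \<and>
     (\<forall>\<sigma>\<in>carrier G. \<forall>\<tau>\<in>carrier G. h (\<sigma> \<otimes>\<^bsub>G\<^esub> \<tau>) = h \<sigma> \<otimes>\<^bsub>H\<^esub> h \<tau>)"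
  by (auto simp: Hom_def Map_def hom_def PiE_def)

text \<open>
  By the product rule, \<open>\<beta>(\<sigma>\<tau>) = \<beta>(\<sigma>) \<beta>(\<tau>)\<close> equates two factorised elements of the holomorph.
  Uniqueness of the factors splits it into one equation for \<open>\<ff>\<close> and one for \<open>\<gg>\<close>.
\<close>

lemma beta_in_Hom_iff:
  assumes "group G" "group N" and \<ff>: "\<ff> \<in> Map G (AutoGroup N)" and \<gg>: "\<gg> \<in> Map G N"
  shows "beta G N \<ff> \<gg> \<in> Hom G (Hol N) \<longleftrightarrow> \<ff> \<in> Hom G (AutoGroup N) \<and> \<gg> \<in> crossed_homs G N \<ff>"
proof -
  interpret G: group G by fact
  interpret N: group N by fact
  have "beta G N \<ff> \<gg> (\<sigma> \<otimes>\<^bsub>G\<^esub> \<tau>) = beta G N \<ff> \<gg> \<sigma> \<otimes>\<^bsub>Hol N\<^esub> beta G N \<ff> \<gg> \<tau> \<longleftrightarrow>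
      \<ff> (\<sigma> \<otimes>\<^bsub>G\<^esub> \<tau>) = \<ff> \<sigma> \<otimes>\<^bsub>AutoGroup N\<^esub> \<ff> \<tau> \<and> \<gg> (\<sigma> \<otimes>\<^bsub>G\<^esub> \<tau>) = \<gg> \<sigma> \<otimes>\<^bsub>N\<^esub> \<ff> \<sigma> (\<gg> \<tau>)"
    if \<sigma>: "\<sigma> \<in> carrier G" and \<tau>: "\<tau> \<in> carrier G" for \<sigma> \<tau>
  proof -
    have f: "\<ff> \<sigma> \<in> auto N" "\<ff> \<tau> \<in> auto N" "\<ff> (\<sigma> \<otimes>\<^bsub>G\<^esub> \<tau>) \<in> auto N"
      and g: "\<gg> \<sigma> \<in> carrier N" "\<gg> \<tau> \<in> carrier N" "\<gg> (\<sigma> \<otimes>\<^bsub>G\<^esub> \<tau>) \<in> carrier N"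
      using \<ff> \<gg> \<sigma> \<tau> by (auto simp: Map_def carrier_AutoGroup)
    have "\<ff> \<sigma> \<otimes>\<^bsub>Perm N\<^esub> \<ff> \<tau> \<in> auto N" "\<gg> \<sigma> \<otimes>\<^bsub>N\<^esub> \<ff> \<sigma> (\<gg> \<tau>) \<in> carrier N"
      using f g N.subgroup_auto by (auto dest: subgroup.m_closed simp: N.auto_closed)
    with f g have "hol_elem N (\<gg> (\<sigma> \<otimes>\<^bsub>G\<^esub> \<tau>)) (\<ff> (\<sigma> \<otimes>\<^bsub>G\<^esub> \<tau>))
          = hol_elem N (\<gg> \<sigma> \<otimes>\<^bsub>N\<^esub> \<ff> \<sigma> (\<gg> \<tau>)) (\<ff> \<sigma> \<otimes>\<^bsub>Perm N\<^esub> \<ff> \<tau>) \<longleftrightarrow>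
        \<ff> (\<sigma> \<otimes>\<^bsub>G\<^esub> \<tau>) = \<ff> \<sigma> \<otimes>\<^bsub>Perm N\<^esub> \<ff> \<tau> \<and> \<gg> (\<sigma> \<otimes>\<^bsub>G\<^esub> \<tau>) = \<gg> \<sigma> \<otimes>\<^bsub>N\<^esub> \<ff> \<sigma> (\<gg> \<tau>)"
      using N.hol_elem_inject by metis
    then show ?thesis
      using \<sigma> \<tau> f g by (simp add: beta_def mult_Hol mult_AutoGroup N.hol_elem_mult)
  qed
  then show ?thesis
    using \<ff> \<gg> beta_in_Map[OF \<open>group N\<close> \<ff> \<gg>] by (auto simp: Hom_iff crossed_homs_def)
qed

section \<open>Regular images\<close>

lemma Hom_Hol_image_subgroup:
  assumes "group G" "group N" "\<beta> \<in> Hom G (Hol N)"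
  shows "subgroup (\<beta> ` carrier G) (Perm N)"
proof -
  have "\<beta> \<in> hom G (Perm N)"
    using assms(2,3) by (auto simp: Hom_def hom_def Hol_def group.carrier_Hol_iff Pi_iff
        normalizer_def stabilizer_def)
  then interpret group_hom G "Perm N" \<beta>
    using assms(1) group_BijGroup by (simp add: group_hom_def group_hom_axioms_def)
  show ?thesis
    by (rule img_is_subgroup)
qed

text \<open>
  Evaluation at \<open>1\<close> after \<open>\<beta>\<close> is \<open>\<sigma> \<mapsto> \<gg>(\<sigma>)\<inverse>\<close>, so a bijective \<open>\<gg>\<close> makes evaluation on \<open>\<beta>(G)\<close>
  bijective. For the converse \<open>\<beta>\<close> has to be injective, which follows by counting:
  regularity gives \<open>|\<beta>(G)| = |N| = |G|\<close>.
\<close>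

lemma beta_in_Reg_Hol_iff:
  assumes "group G" "group N" "finite (carrier G)" "order G = order N"
    and \<ff>: "\<ff> \<in> Map G (AutoGroup N)" and \<gg>: "\<gg> \<in> Map G N"
  shows "beta G N \<ff> \<gg> \<in> Reg_Hol G N \<longleftrightarrow>
    \<ff> \<in> Hom G (AutoGroup N) \<and> \<gg> \<in> bij_crossed_homs G N \<ff>"
proof -
  interpret N: group N by fact
  let ?\<beta> = "beta G N \<ff> \<gg>" and ?ev = "\<lambda>\<pi>. \<pi> \<one>\<^bsub>N\<^esub>"
  have ev_beta: "(?ev \<circ> ?\<beta>) \<sigma> = inv\<^bsub>N\<^esub> \<gg> \<sigma>" if "\<sigma> \<in> carrier G" for \<sigma>
  proof -
    have "\<ff> \<sigma> \<in> auto N" "\<gg> \<sigma> \<in> carrier N"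
      using \<ff> \<gg> that by (auto simp: Map_def carrier_AutoGroup)
    then show ?thesis
      using that by (simp add: beta_def N.hol_elem_one)
  qed
  have bij_inv: "bij_betw (m_inv N) (carrier N) (carrier N)"
    by (rule bij_betw_byWitness[where f' = "m_inv N"]) auto
  have "\<gg> ` carrier G \<subseteq> carrier N"
    using \<gg> by (auto simp: Map_def)
  then have "bij_betw \<gg> (carrier G) (carrier N) \<longleftrightarrow>
      bij_betw (m_inv N \<circ> \<gg>) (carrier G) (carrier N)"
    using bij_betw_comp_iff2[OF bij_inv] by blast
  also have "\<dots> \<longleftrightarrow> bij_betw (?ev \<circ> ?\<beta>) (carrier G) (carrier N)"
    by (rule bij_betw_cong) (use ev_beta in simp)
  also have "\<dots> \<longleftrightarrow> bij_betw ?ev (?\<beta> ` carrier G) (carrier N)"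
  proof
    assume "bij_betw (?ev \<circ> ?\<beta>) (carrier G) (carrier N)"
    then show "bij_betw ?ev (?\<beta> ` carrier G) (carrier N)"
      by (simp add: bij_betw_def inj_on_imageI image_comp)
  next
    assume ev: "bij_betw ?ev (?\<beta> ` carrier G) (carrier N)"
    then have "card (?\<beta> ` carrier G) = card (carrier G)"
      using assms(4) bij_betw_same_card[OF ev] by (simp add: order_def)
    then have "bij_betw ?\<beta> (carrier G) (?\<beta> ` carrier G)"
      using assms(3) by (simp add: bij_betw_def eq_card_imp_inj_on)
    then show "bij_betw (?ev \<circ> ?\<beta>) (carrier G) (carrier N)"
      using ev by (rule bij_betw_trans)
  qed
  finally have "bij_betw \<gg> (carrier G) (carrier N) \<longleftrightarrow>
      bij_betw ?ev (?\<beta> ` carrier G) (carrier N)" .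
  then show ?thesis
    using beta_in_Hom_iff[OF assms(1,2) \<ff> \<gg>] Hom_Hol_image_subgroup[OF assms(1,2)]
    by (auto simp: Reg_Hol_def bij_crossed_homs_def regular_subgroup_def)
qed

theorem proposition2p1:
  fixes G :: "('a, 'c) monoid_scheme" and N :: "('b, 'd) monoid_scheme"
  assumes "group G" and "group N"
    and "finite (carrier G)" and "finite (carrier N)"
    and "order G = order N"
  shows "Map G (Hol N) =
           {beta G N \<ff> \<gg> | \<ff> \<gg>. \<ff> \<in> Map G (AutoGroup N) \<and> \<gg> \<in> Map G N} \<and>
         Hom G (Hol N) =
           {beta G N \<ff> \<gg> | \<ff> \<gg>. \<ff> \<in> Hom G (AutoGroup N) \<and> \<gg> \<in> crossed_homs G N \<ff>} \<and>
         Reg_Hol G N =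
           {beta G N \<ff> \<gg> | \<ff> \<gg>. \<ff> \<in> Hom G (AutoGroup N) \<and> \<gg> \<in> bij_crossed_homs G N \<ff>}"
proof -
  have Map: "Map G (Hol N) =
      {beta G N \<ff> \<gg> | \<ff> \<gg>. \<ff> \<in> Map G (AutoGroup N) \<and> \<gg> \<in> Map G N}"
    using beta_in_Map[OF assms(2)] by (blast elim: Map_Hol_imp_beta[OF assms(2)])
  \<comment> \<open>The other two families lie in \<open>Map G (Hol N)\<close>, so their members already have the form
    \<open>beta G N \<ff> \<gg>\<close>; a criterion for such a map to belong to the family determines it.\<close>
  have subfamily: "A = {beta G N \<ff> \<gg> | \<ff> \<gg>. P \<ff> \<gg>}"
    if "A \<subseteq> Map G (Hol N)"
      and "\<And>\<ff> \<gg>. P \<ff> \<gg> \<Longrightarrow> \<ff> \<in> Map G (AutoGroup N) \<and> \<gg> \<in> Map G N"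
      and "\<And>\<ff> \<gg>. \<lbrakk>\<ff> \<in> Map G (AutoGroup N); \<gg> \<in> Map G N\<rbrakk> \<Longrightarrow> beta G N \<ff> \<gg> \<in> A \<longleftrightarrow> P \<ff> \<gg>"
    for A P
    using that unfolding Map by blast
  have Map_if: "\<ff> \<in> Map G (AutoGroup N) \<and> \<gg> \<in> Map G N"
    if "\<ff> \<in> Hom G (AutoGroup N) \<and> \<gg> \<in> crossed_homs G N \<ff>" for \<ff> \<gg>
    using that by (simp add: Hom_iff crossed_homs_def)
  have "Hom G (Hol N) =
      {beta G N \<ff> \<gg> | \<ff> \<gg>. \<ff> \<in> Hom G (AutoGroup N) \<and> \<gg> \<in> crossed_homs G N \<ff>}"
  proof (rule subfamily)
    show "Hom G (Hol N) \<subseteq> Map G (Hol N)"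
      by (auto simp: Hom_iff)
  qed (fact Map_if, fact beta_in_Hom_iff[OF assms(1,2)])
  moreover have "Reg_Hol G N =
      {beta G N \<ff> \<gg> | \<ff> \<gg>. \<ff> \<in> Hom G (AutoGroup N) \<and> \<gg> \<in> bij_crossed_homs G N \<ff>}"
  proof (rule subfamily)
    show "Reg_Hol G N \<subseteq> Map G (Hol N)"
      by (auto simp: Reg_Hol_def Hom_iff)
  qed (use Map_if in \<open>force simp: bij_crossed_homs_def\<close>, fact beta_in_Reg_Hol_iff[OF assms(1,2,3,5)])
  ultimately show ?thesis
    using Map by blast
qed

end
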